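(* Let $\lambda,\mu\in\mathbb R$ with $\lambda>0$ and $\mu>0$. Then the equation $\Delta u=\mu\,e^u-\lambda$ has the unique solution $u=t_0\cdot 1$, with $t_0=\ln(\lambda/\mu)$, among self-adjoint elements $u=u^*\in A_\theta^\infty$.
   Context: Fix $\theta\in\mathbb R\smallsetminus\mathbb Q$. $A_\theta$ is the (universal) unital $C^*$-algebra generated by two unitaries $U,V$ with $UV=e^{2\pi i\theta}VU$. Its smooth subalgebra is $A_\theta^\infty=\{\sum_{m,n\in\mathbb Z}c_{m,n}U^mV^n: (c_{m,n})\text{ rapidly decreasing}\}$. The commuting derivations $\delta_1,\delta_2$ of $A_\theta^\infty$ are given by $\delta_1(U)=2\pi iU$, $\delta_1(V)=0$, $\delta_2(U)=0$, $\delta_2(V)=2\pi iV$, so $\delta_1(\sum c_{m,n}U^mV^n)=2\pi i\sum m\,c_{m,n}U^mV^n$ and $\delta_2(\sum c_{m,n}U^mV^n)=2\pi i\sum n\,c_{m,n}U^mV^n$. The Laplacian is $\Delta=\delta_1^2+\delta_2^2$. The exponential $e^u$ is taken in the $C^*$-algebra $A_\theta$, and a scalar $\lambda$ is identified with $\lambda 1\in A_\theta$. *)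

theory Defs
  imports "HOL-Analysis.Analysis" "HOL-Algebra.Module"
begin

text \<open>Nonzero unital complex \<open>C\<^sup>*\<close>-algebras as types. The real Banach algebra structure, and with it
  \<open>exp\<close> and \<open>infsum\<close>, is that of the library; \<open>norm 1 = 1\<close> is part of \<^class>\<open>real_normed_algebra_1\<close>.\<close>

class cstar_algebra = real_normed_algebra_1 + banach +
  fixes scaleC :: "complex \<Rightarrow> 'a \<Rightarrow> 'a" (infixr \<open>*\<^sub>C\<close> 75)
    and adj :: "'a \<Rightarrow> 'a"
  assumes scaleC_add_right: "c *\<^sub>C (x + y) = c *\<^sub>C x + c *\<^sub>C y"
    and scaleC_add_left: "(c + d) *\<^sub>C x = c *\<^sub>C x + d *\<^sub>C x"
    and scaleC_scaleC: "c *\<^sub>C (d *\<^sub>C x) = (c * d) *\<^sub>C x"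
    and scaleC_of_real: "complex_of_real r *\<^sub>C x = r *\<^sub>R x"
    and mult_scaleC_left: "(c *\<^sub>C x) * y = c *\<^sub>C (x * y)"
    and mult_scaleC_right: "x * (c *\<^sub>C y) = c *\<^sub>C (x * y)"
    and norm_scaleC: "norm (c *\<^sub>C x) = cmod c * norm x"
    and adj_add: "adj (x + y) = adj x + adj y"
    and adj_scaleC: "adj (c *\<^sub>C x) = cnj c *\<^sub>C adj x"
    and adj_mult: "adj (x * y) = adj y * adj x"
    and adj_adj: "adj (adj x) = x"
    and cstar_identity: "norm (adj x * x) = (norm x)\<^sup>2"

text \<open>Unital \<open>C\<^sup>*\<close>-algebras with an explicit carrier set (the zero algebra allowed). They are needed
  because the universal property below quantifies over \<open>C\<^sup>*\<close>-algebras inside a formula.\<close>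

definition complex_ring :: "complex ring" where
  "complex_ring =
     \<lparr>carrier = UNIV, monoid.mult = (*), one = 1, ring.zero = 0, add = (+)\<rparr>"

record 'b cstar_structure = "(complex, 'b) module" +
  star :: "'b \<Rightarrow> 'b"
  nrm :: "'b \<Rightarrow> real"

locale unital_cstar = ring B + Module.module complex_ring B
  for B :: "'b cstar_structure" (structure) +
  assumes smult_mult_left:
      "\<lbrakk>x \<in> carrier B; y \<in> carrier B\<rbrakk> \<Longrightarrow> (c \<odot> x) \<otimes> y = c \<odot> (x \<otimes> y)"
    and smult_mult_right:
      "\<lbrakk>x \<in> carrier B; y \<in> carrier B\<rbrakk> \<Longrightarrow> x \<otimes> (c \<odot> y) = c \<odot> (x \<otimes> y)"
    and nrm_nonneg: "x \<in> carrier B \<Longrightarrow> 0 \<le> nrm B x"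
    and nrm_eq_zero: "x \<in> carrier B \<Longrightarrow> nrm B x = 0 \<longleftrightarrow> x = \<zero>"
    and nrm_triangle:
      "\<lbrakk>x \<in> carrier B; y \<in> carrier B\<rbrakk> \<Longrightarrow> nrm B (x \<oplus> y) \<le> nrm B x + nrm B y"
    and nrm_smult: "x \<in> carrier B \<Longrightarrow> nrm B (c \<odot> x) = cmod c * nrm B x"
    and nrm_mult:
      "\<lbrakk>x \<in> carrier B; y \<in> carrier B\<rbrakk> \<Longrightarrow> nrm B (x \<otimes> y) \<le> nrm B x * nrm B y"
    and nrm_complete:
      "\<lbrakk>\<forall>n. s n \<in> carrier B; \<forall>e>0. \<exists>N. \<forall>m\<ge>N. \<forall>n\<ge>N. nrm B (s m \<ominus> s n) < e\<rbrakk>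
        \<Longrightarrow> \<exists>l\<in>carrier B. (\<lambda>n. nrm B (s n \<ominus> l)) \<longlonglongrightarrow> 0"
    and star_closed: "x \<in> carrier B \<Longrightarrow> star B x \<in> carrier B"
    and star_add:
      "\<lbrakk>x \<in> carrier B; y \<in> carrier B\<rbrakk> \<Longrightarrow> star B (x \<oplus> y) = star B x \<oplus> star B y"
    and star_smult: "x \<in> carrier B \<Longrightarrow> star B (c \<odot> x) = cnj c \<odot> star B x"
    and star_mult:
      "\<lbrakk>x \<in> carrier B; y \<in> carrier B\<rbrakk> \<Longrightarrow> star B (x \<otimes> y) = star B y \<otimes> star B x"
    and star_star: "x \<in> carrier B \<Longrightarrow> star B (star B x) = x"
    and nrm_star_mult: "x \<in> carrier B \<Longrightarrow> nrm B (star B x \<otimes> x) = (nrm B x)\<^sup>2"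

definition type_cstar :: "'a::cstar_algebra cstar_structure" where
  "type_cstar =
     \<lparr>carrier = UNIV, monoid.mult = (*), one = 1, ring.zero = 0, add = (+),
      smult = scaleC, star = adj, nrm = norm\<rparr>"

lemma unital_cstar_type_cstar: "unital_cstar (type_cstar :: 'a::cstar_algebra cstar_structure)"
proof -
  let ?A = "type_cstar :: 'a cstar_structure"
  have ring: "ring ?A"
    unfolding type_cstar_def
    by (intro ringI abelian_groupI monoidI)
       (auto simp: algebra_simps intro: exI[of _ "- x" for x :: 'a] left_minus)
  have cring: "cring complex_ring"
    unfolding complex_ring_def
    by (intro cringI abelian_groupI comm_monoidI)
       (auto simp: algebra_simps intro: exI[of _ "- x" for x :: complex] left_minus)
  interpret R: ring ?A by (rule ring)
  have scaleC_one: "1 *\<^sub>C x = x" for x :: 'a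
    using scaleC_of_real[of 1 x] by simp
  have mod: "Module.module complex_ring ?A"
    using cring R.abelian_group_axioms
    by (rule Module.moduleI)
       (auto simp: type_cstar_def complex_ring_def scaleC_add_right scaleC_add_left
          scaleC_scaleC scaleC_one)
  have minus: "x \<ominus>\<^bsub>?A\<^esub> y = x - y" for x y :: 'a
  proof -
    have "(x \<ominus>\<^bsub>?A\<^esub> y) \<oplus>\<^bsub>?A\<^esub> y = x"
      using R.l_neg[of y]
      by (simp add: a_minus_def type_cstar_def add.assoc)
    then show ?thesis
      by (simp add: type_cstar_def eq_diff_eq)
  qed
  have complete: "\<exists>l\<in>carrier ?A. (\<lambda>n. nrm ?A (s n \<ominus>\<^bsub>?A\<^esub> l)) \<longlonglongrightarrow> 0"
    if "\<forall>e>0. \<exists>N. \<forall>m\<ge>N. \<forall>n\<ge>N. nrm ?A (s m \<ominus>\<^bsub>?A\<^esub> s n) < e" for s :: "nat \<Rightarrow> 'a"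
  proof -
    have "Cauchy s"
      using that unfolding minus by (simp add: Cauchy_def dist_norm type_cstar_def)
    then obtain l where "s \<longlonglongrightarrow> l"
      using Cauchy_convergent_iff convergent_def by blast
    then have "(\<lambda>n. norm (s n - l)) \<longlonglongrightarrow> 0"
      by (simp add: LIM_zero tendsto_norm_zero)
    then show ?thesis
      unfolding minus by (auto simp: type_cstar_def)
  qed
  show ?thesis
    by (intro unital_cstar.intro ring mod unital_cstar_axioms.intro complete)
       (auto simp: type_cstar_def mult_scaleC_left mult_scaleC_right norm_triangle_ineq
          norm_scaleC norm_mult_ineq adj_add adj_scaleC adj_mult adj_adj cstar_identity)
qed

definition star_hom :: "'a cstar_structure \<Rightarrow> 'b cstar_structure \<Rightarrow> ('a \<Rightarrow> 'b) set" where
  "star_hom A B = {\<phi> \<in> ring_hom A B. \<forall>x\<in>carrier A.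
     (\<forall>c. \<phi> (c \<odot>\<^bsub>A\<^esub> x) = c \<odot>\<^bsub>B\<^esub> \<phi> x) \<and> \<phi> (star A x) = star B (\<phi> x)}"

definition unitary_elem :: "'b cstar_structure \<Rightarrow> 'b \<Rightarrow> bool" where
  "unitary_elem B u \<longleftrightarrow>
     u \<in> carrier B \<and> star B u \<otimes>\<^bsub>B\<^esub> u = \<one>\<^bsub>B\<^esub> \<and> u \<otimes>\<^bsub>B\<^esub> star B u = \<one>\<^bsub>B\<^esub>"

definition rotation_pair :: "'b cstar_structure \<Rightarrow> real \<Rightarrow> 'b \<Rightarrow> 'b \<Rightarrow> bool" where
  "rotation_pair B \<theta> u v \<longleftrightarrow> unitary_elem B u \<and> unitary_elem B v \<and>
     u \<otimes>\<^bsub>B\<^esub> v = exp (2 * complex_of_real pi * \<i> * complex_of_real \<theta>) \<odot>\<^bsub>B\<^esub> (v \<otimes>\<^bsub>B\<^esub> u)"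

definition closed_star_subalgebra :: "'a::cstar_algebra set \<Rightarrow> bool" where
  "closed_star_subalgebra S \<longleftrightarrow> closed S \<and> 1 \<in> S \<and>
     (\<forall>x\<in>S. \<forall>y\<in>S. x + y \<in> S \<and> x * y \<in> S) \<and> (\<forall>x\<in>S. adj x \<in> S \<and> (\<forall>c. c *\<^sub>C x \<in> S))"

text \<open>\<open>'a\<close> is the universal unital \<open>C\<^sup>*\<close>-algebra generated by unitaries \<open>U\<close>, \<open>V\<close> with
  \<open>U V = e\<^sup>2\<^sup>\<pi>\<^sup>i\<^sup>\<theta> V U\<close>. Letting the test algebras \<open>B\<close> range over \<open>C\<^sup>*\<close>-algebras carried by subsets
  of \<open>'a\<close> loses no generality: only the \<open>C\<^sup>*\<close>-subalgebra generated by \<open>u\<close> and \<open>v\<close> matters, which is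
  separable, hence has at most the cardinality of the continuum, and \<open>'a\<close> contains a copy of the
  complex numbers.\<close>

definition rotation_algebra :: "real \<Rightarrow> 'a::cstar_algebra \<Rightarrow> 'a \<Rightarrow> bool" where
  "rotation_algebra \<theta> U V \<longleftrightarrow>
     rotation_pair type_cstar \<theta> U V \<and>
     (\<forall>S. closed_star_subalgebra S \<and> U \<in> S \<and> V \<in> S \<longrightarrow> S = UNIV) \<and>
     (\<forall>(B :: 'a cstar_structure) u v. unital_cstar B \<and> rotation_pair B \<theta> u v \<longrightarrow>
        (\<exists>!\<phi>. \<phi> \<in> star_hom type_cstar B \<and> \<phi> U = u \<and> \<phi> V = v))"

text \<open>Integer powers of a unitary, whose inverse is its adjoint.\<close>

definition upow :: "'a::cstar_algebra \<Rightarrow> int \<Rightarrow> 'a" where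
  "upow W k = (if 0 \<le> k then W ^ nat k else adj W ^ nat (- k))"

definition rapidly_decreasing :: "(int \<Rightarrow> int \<Rightarrow> complex) \<Rightarrow> bool" where
  "rapidly_decreasing c \<longleftrightarrow>
     (\<forall>k::nat. \<exists>C. \<forall>m n. (1 + \<bar>real_of_int m\<bar> + \<bar>real_of_int n\<bar>) ^ k * cmod (c m n) \<le> C)"

definition fourier_sum :: "'a::cstar_algebra \<Rightarrow> 'a \<Rightarrow> (int \<Rightarrow> int \<Rightarrow> complex) \<Rightarrow> 'a" where
  "fourier_sum U V c = (\<Sum>\<^sub>\<infinity>(m, n)\<in>UNIV. c m n *\<^sub>C (upow U m * upow V n))"

definition smooth_elems :: "'a::cstar_algebra \<Rightarrow> 'a \<Rightarrow> 'a set" where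
  "smooth_elems U V = {fourier_sum U V c |c. rapidly_decreasing c}"

text \<open>The coefficients of a smooth element; in a rotation algebra they are uniquely determined, so
  the choice is immaterial. The derivations below are meaningful on smooth elements only.\<close>

definition fourier_coeff :: "'a::cstar_algebra \<Rightarrow> 'a \<Rightarrow> 'a \<Rightarrow> int \<Rightarrow> int \<Rightarrow> complex" where
  "fourier_coeff U V a = (SOME c. rapidly_decreasing c \<and> a = fourier_sum U V c)"

definition \<delta>\<^sub>1 :: "'a::cstar_algebra \<Rightarrow> 'a \<Rightarrow> 'a \<Rightarrow> 'a" where
  "\<delta>\<^sub>1 U V a = fourier_sum U V
     (\<lambda>m n. 2 * complex_of_real pi * \<i> * of_int m * fourier_coeff U V a m n)"

definition \<delta>\<^sub>2 :: "'a::cstar_algebra \<Rightarrow> 'a \<Rightarrow> 'a \<Rightarrow> 'a" where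
  "\<delta>\<^sub>2 U V a = fourier_sum U V
     (\<lambda>m n. 2 * complex_of_real pi * \<i> * of_int n * fourier_coeff U V a m n)"

definition laplacian :: "'a::cstar_algebra \<Rightarrow> 'a \<Rightarrow> 'a \<Rightarrow> 'a" where
  "laplacian U V a = \<delta>\<^sub>1 U V (\<delta>\<^sub>1 U V a) + \<delta>\<^sub>2 U V (\<delta>\<^sub>2 U V a)"

end

theory Submission
  imports Defs
begin

text \<open>Put \<open>t = ln (\<lambda> / \<mu>)\<close> and \<open>w = u - t\<close>. Since \<open>\<mu> exp t = \<lambda>\<close> and \<open>t\<close> is central, the equation
  becomes \<open>\<Delta>u = \<lambda> (exp w - 1)\<close>, and \<open>w = 0\<close> must be shown. Two estimates contradict each other
  unless \<open>w = 0\<close>.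

  On the one hand, the Laplacian is dissipative: \<open>\<parallel>w\<parallel> \<le> \<parallel>w - \<epsilon> \<Delta>u\<parallel>\<close> for every \<open>\<epsilon> > 0\<close>
  (\<open>laplacian_dissipative\<close>). This is the maximum principle in terms of norms. It holds because \<open>\<Delta>\<close> is the limit of second difference quotients of the gauge
  automorphisms \<open>U \<mapsto> exp (2 \<pi> i s) U\<close> and \<open>V \<mapsto> exp (2 \<pi> i s) V\<close>, and these are contractive. The
  automorphisms come from the universal property (\<open>rotation_algebra_gauge_action\<close>), and the difference
  quotients are controlled by Taylor expansion of Fourier sums (\<open>act_fourier_sum_taylor\<close>). That
  expansion also shows that the derivations do not depend on the Fourier coefficients chosen to
  represent an element.

  On the other hand, \<open>x \<mapsto> exp x - 1\<close> is strictly monotone, so that for small \<open>\<kappa> > 0\<close> the element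
  \<open>w - \<kappa> (exp w - 1)\<close> has norm at most \<open>\<rho> \<parallel>w\<parallel>\<close> with \<open>\<rho> < 1\<close> (\<open>norm_sub_exp_minus_one_le\<close>). Taking
  \<open>\<epsilon> = \<kappa> / \<lambda>\<close> in the first estimate yields \<open>\<parallel>w\<parallel> \<le> \<rho> \<parallel>w\<parallel>\<close>, so \<open>w = 0\<close>.

  The spectral theory behind both estimates is reduced to two elementary facts: for commuting
  self-adjoint elements \<open>\<parallel>a\<^sup>2\<parallel> \<le> \<parallel>a\<^sup>2 + b\<^sup>2\<parallel>\<close> (\<open>norm_square_le_sum_of_squares\<close>), and \<open>1 - z\<close> has a
  self-adjoint square root when \<open>z\<close> is self-adjoint with \<open>\<parallel>z\<parallel> < 1\<close> (\<open>sqrt_one_minus\<close>).\<close>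

section \<open>Basic facts on \<open>C\<^sup>*\<close>-algebras\<close>

lemma scaleC_one [simp]: "1 *\<^sub>C x = (x::'a::cstar_algebra)"
  using scaleC_of_real[of 1 x] by simp

lemma bounded_linear_scaleC: "bounded_linear (\<lambda>x::'a::cstar_algebra. c *\<^sub>C x)"
proof (rule bounded_linear_intro)
  show "c *\<^sub>C (x + y) = c *\<^sub>C x + c *\<^sub>C y" for x y :: 'a by (rule scaleC_add_right)
  show "c *\<^sub>C (r *\<^sub>R x) = r *\<^sub>R (c *\<^sub>C x)" for r and x :: 'a
    by (simp add: scaleC_of_real[symmetric] scaleC_scaleC mult.commute)
  show "norm (c *\<^sub>C x) \<le> norm x * cmod c" for x :: 'a by (simp add: norm_scaleC)
qed

lemma bounded_linear_scaleC_left: "bounded_linear (\<lambda>c. c *\<^sub>C (x::'a::cstar_algebra))"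
proof (rule bounded_linear_intro)
  show "(c + d) *\<^sub>C x = c *\<^sub>C x + d *\<^sub>C x" for c d by (rule scaleC_add_left)
  show "(r *\<^sub>R c) *\<^sub>C x = r *\<^sub>R (c *\<^sub>C x)" for r c
    by (simp add: scaleC_of_real[symmetric] scaleC_scaleC scaleR_conv_of_real)
  show "norm (c *\<^sub>C x) \<le> norm c * norm x" for c by (simp add: norm_scaleC)
qed

lemmas scaleC_minus_left = linear_neg[OF bounded_linear.linear[OF bounded_linear_scaleC_left]]
lemmas scaleC_diff_left = linear_diff[OF bounded_linear.linear[OF bounded_linear_scaleC_left]]
lemmas scaleC_zero_left = linear_0[OF bounded_linear.linear[OF bounded_linear_scaleC_left]]

lemma norm_adj: "norm (adj x) = norm (x::'a::cstar_algebra)"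
proof -
  have *: "norm y \<le> norm (adj y)" for y :: 'a
  proof (cases "y = 0")
    case False
    have "norm y * norm y \<le> norm (adj y) * norm y"
      using norm_mult_ineq[of "adj y" y] cstar_identity[of y] by (simp add: power2_eq_square)
    then show ?thesis using False by simp
  qed simp
  from *[of x] *[of "adj x"] show ?thesis by (simp add: adj_adj)
qed

lemma bounded_linear_adj: "bounded_linear (adj :: 'a::cstar_algebra \<Rightarrow> 'a)"
proof (rule bounded_linear_intro)
  show "adj (x + y) = adj x + adj y" for x y :: 'a by (rule adj_add)
  show "adj (r *\<^sub>R x) = r *\<^sub>R adj x" for r and x :: 'a
    by (simp add: scaleC_of_real[symmetric] adj_scaleC)
  show "norm (adj x) \<le> norm x * 1" for x :: 'a by (simp add: norm_adj)
qed

lemmas adj_diff = linear_diff[OF bounded_linear.linear[OF bounded_linear_adj]]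
lemmas adj_minus = linear_neg[OF bounded_linear.linear[OF bounded_linear_adj]]
lemmas adj_scaleR = linear_scale[OF bounded_linear.linear[OF bounded_linear_adj]]

lemma adj_one [simp]: "adj 1 = (1::'a::cstar_algebra)"
  by (metis adj_adj adj_mult mult.right_neutral mult.left_neutral)

lemma adj_of_real [simp]: "adj (of_real r) = (of_real r :: 'a::cstar_algebra)"
  by (simp add: of_real_def adj_scaleR)

lemma adj_power: "adj (x ^ n) = adj (x::'a::cstar_algebra) ^ n"
  by (induction n) (simp_all add: adj_mult power_commutes)

lemma adj_exp: "adj (exp x) = exp (adj (x::'a::cstar_algebra))"
  unfolding exp_def
  by (subst bounded_linear.suminf[OF bounded_linear_adj summable_exp_generic])
     (simp add: adj_scaleR adj_power)

lemma norm_square_self_adjoint: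
  assumes "adj a = (a::'a::cstar_algebra)"
  shows "norm (a * a) = (norm a)\<^sup>2"
  using cstar_identity[of a] assms by simp

text \<open>This inequality replaces the order on self-adjoint elements in all that follows. With
  \<open>z = a + i b\<close> one has \<open>z\<^sup>* z = a\<^sup>2 + b\<^sup>2\<close> because \<open>a\<close> and \<open>b\<close> commute, and \<open>a\<close> is the mean of
  \<open>z\<close> and \<open>z\<^sup>*\<close>, which have the same norm; so \<open>\<parallel>a\<parallel> \<le> \<parallel>z\<parallel>\<close>, and the \<open>C\<^sup>*\<close>-identity squares this.\<close>

lemma norm_square_le_sum_of_squares:
  fixes a b :: "'a::cstar_algebra"
  assumes a: "adj a = a" and b: "adj b = b" and ab: "a * b = b * a"
  shows "norm (a * a) \<le> norm (a * a + b * b)"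
proof -
  let ?z = "a + \<i> *\<^sub>C b" and ?w = "a - \<i> *\<^sub>C b"
  have ib: "(- \<i>) *\<^sub>C b = - (\<i> *\<^sub>C b)"
    by (rule scaleC_minus_left)
  have adj_z: "adj ?z = ?w"
    using a b ib by (simp add: adj_add adj_scaleC)
  have "?w * ?z = a * a + b * b"
    using ab scaleC_of_real[of "-1" "b * b"]
    by (simp add: algebra_simps mult_scaleC_left mult_scaleC_right scaleC_scaleC scaleC_add_right
        bounded_linear.linear[OF bounded_linear_scaleC, THEN linear_diff])
  then have z: "norm (a * a + b * b) = (norm ?z)\<^sup>2"
    using cstar_identity[of ?z] adj_z by simp
  have w: "norm ?w = norm ?z" using norm_adj[of ?z] adj_z by simp
  have "2 *\<^sub>R a = ?z + ?w" by (simp add: scaleR_2)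
  then have "2 * norm a \<le> norm ?z + norm ?w"
    by (metis norm_triangle_ineq norm_scaleR abs_numeral)
  then have "norm a \<le> norm ?z" using w by simp
  then show ?thesis
    using z norm_square_self_adjoint[OF a] by (simp add: power_mono)
qed

text \<open>A fragment of the functional calculus: \<open>b = 1 - y\<close> is a square root of \<open>1 - z\<close> exactly when
  \<open>y = (z + y\<^sup>2) / 2\<close>. The right-hand side contracts the ball of radius \<open>\<parallel>z\<parallel> < 1\<close> with factor \<open>\<parallel>z\<parallel>\<close>.
  Carrying out the Banach fixed point argument among the self-adjoint elements that commute with
  everything that commutes with \<open>z\<close> gives the two side conditions on \<open>b\<close>.\<close>

lemma sqrt_one_minus:
  fixes z :: "'a::cstar_algebra"
  assumes z: "adj z = z" and nz: "norm z < 1"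
  obtains b where "adj b = b" "b * b = 1 - z" "\<And>v. z * v = v * z \<Longrightarrow> b * v = v * b"
proof -
  define S where "S = {y::'a. norm y \<le> norm z} \<inter> {y. adj y = y} \<inter>
      (\<Inter>v\<in>{v. z * v = v * z}. {y. y * v = v * y})"
  define f where "f y = (1/2) *\<^sub>R (z + y * y)" for y :: 'a
  have S_iff: "y \<in> S \<longleftrightarrow> norm y \<le> norm z \<and> adj y = y \<and> (\<forall>v. z * v = v * z \<longrightarrow> y * v = v * y)" for y
    unfolding S_def by blast
  have SD: "norm y \<le> norm z" "adj y = y" "z * v = v * z \<Longrightarrow> y * v = v * y" if "y \<in> S" for y v
    using that unfolding S_iff by blast+
  have "closed S"
    unfolding S_def
    by (intro closed_Int closed_INT ballI closed_Collect_le closed_Collect_eq continuous_intros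
         linear_continuous_on[OF bounded_linear_adj])
  then have "complete S" by (simp add: complete_eq_closed)
  moreover have "S \<noteq> {}"
    using z S_iff[of z] by blast
  moreover have "f ` S \<subseteq> S"
  proof (safe)
    fix y assume y: "y \<in> S"
    have "norm (y * y) \<le> norm z * norm z"
      using SD(1)[OF y] by (intro norm_mult_ineq[THEN order_trans] mult_mono) auto
    also have "\<dots> \<le> 1 * norm z" using nz by (intro mult_right_mono) auto
    finally have "norm (f y) \<le> norm z"
      using norm_triangle_ineq[of z "y * y"] by (simp add: f_def)
    moreover have "adj (f y) = f y"
      using SD(2)[OF y] z by (simp add: f_def adj_scaleR adj_add adj_mult)
    moreover have "f y * v = v * f y" if v: "z * v = v * z" for v
    proof -
      have "y * v = v * y" by (rule SD(3)[OF y v])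
      then have "y * y * v = v * (y * y)" by (metis mult.assoc)
      then show ?thesis using v by (simp add: f_def distrib_left distrib_right)
    qed
    ultimately show "f y \<in> S" unfolding S_iff by blast
  qed
  moreover have "dist (f x) (f y) \<le> norm z * dist x y" if x: "x \<in> S" and y: "y \<in> S" for x y
  proof -
    have "x * y = y * x" by (rule SD(3)[OF x SD(3)[OF y refl, symmetric]])
    then have "f x - f y = (1/2) *\<^sub>R ((x + y) * (x - y))"
      by (simp add: f_def algebra_simps)
    then have "norm (f x - f y) \<le> (1/2) * (norm (x + y) * norm (x - y))"
      using norm_mult_ineq[of "x + y" "x - y"] by simp
    also have "\<dots> \<le> (1/2) * ((2 * norm z) * norm (x - y))"
      using SD(1)[OF x] SD(1)[OF y] norm_triangle_ineq[of x y]
      by (intro mult_left_mono mult_right_mono) auto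
    finally show ?thesis by (simp add: dist_norm)
  qed
  ultimately obtain y where y: "y \<in> S" "f y = y"
    using Banach_fix[of S "norm z" f] nz by auto
  have "2 *\<^sub>R y = 2 *\<^sub>R f y" using y by simp
  then have yy: "y + y = z + y * y" by (simp add: f_def scaleR_2)
  show thesis
  proof (rule that[of "1 - y"])
    show "adj (1 - y) = 1 - y" using SD(2)[OF y(1)] by (simp add: adj_diff)
    have "(1 - y) * (1 - y) = 1 + y * y - (y + y)" by (simp add: algebra_simps)
    then show "(1 - y) * (1 - y) = 1 - z" by (simp add: yy)
    show "(1 - y) * v = v * (1 - y)" if "z * v = v * z" for v
      using SD(3)[OF y(1) that] by (simp add: algebra_simps)
  qed
qed

section \<open>The exponential nonlinearity\<close>

text \<open>In terms of spectra: that of \<open>exp x\<close> lies in \<open>[exp (- R), exp R]\<close>, so for small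
  \<open>\<kappa>\<close> that of \<open>1 - \<kappa> exp x\<close> stays positive and strictly below \<open>1\<close>. The proof exhibits the
  witnesses of positivity: with \<open>\<delta> = exp (- R) / 2\<close> both \<open>1 - \<kappa> exp x = b\<^sup>2\<close> and
  \<open>\<kappa> (exp x - \<delta>) = d\<^sup>2\<close> are squares, and \<open>b\<^sup>2 + d\<^sup>2\<close> is the scalar \<open>1 - \<kappa> \<delta>\<close>.\<close>

lemma norm_one_minus_exp_le:
  fixes x :: "'a::cstar_algebra" and \<kappa> R :: real
  assumes x: "adj x = x" and R: "norm x \<le> R" and \<kappa>: "0 < \<kappa>" "\<kappa> * exp R \<le> 1/2"
  shows "norm (1 - \<kappa> *\<^sub>R exp x) \<le> 1 - \<kappa> * (exp (- R) / 2)"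
proof -
  define \<delta> where "\<delta> = exp (- R) / 2"
  define q where "q = exp ((1/2) *\<^sub>R x)"
  have q: "adj q = q" "q * q = exp x"
    by (simp_all add: q_def adj_exp adj_scaleR x flip: exp_add_commuting scaleR_add_left)
  have exp_bound: "norm (exp y) \<le> exp R" if "norm y \<le> R" for y :: 'a
    using norm_exp[of y] that by (meson exp_le_cancel_iff order_trans)
  have "norm (\<delta> *\<^sub>R exp (- x)) \<le> \<delta> * exp R"
    using exp_bound[of "- x"] R by (simp add: \<delta>_def)
  also have "\<dots> = 1/2" by (simp add: \<delta>_def exp_minus)
  finally have "norm (\<delta> *\<^sub>R exp (- x)) < 1" by simp
  moreover have "adj (\<delta> *\<^sub>R exp (- x)) = \<delta> *\<^sub>R exp (- x)"
    by (simp add: adj_scaleR adj_exp adj_minus x)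
  ultimately obtain a where a: "adj a = a" "a * a = 1 - \<delta> *\<^sub>R exp (- x)"
    "\<And>v. (\<delta> *\<^sub>R exp (- x)) * v = v * (\<delta> *\<^sub>R exp (- x)) \<Longrightarrow> a * v = v * a"
    using sqrt_one_minus by blast
  have comm: "exp y * exp z = exp z * exp y" if "y * z = z * y" for y z :: 'a
    using that by (metis exp_add_commuting add.commute)
  have aq: "a * q = q * a"
    by (rule a(3)) (simp add: q_def comm)
  \<comment> \<open>This makes \<open>d\<^sup>2 = \<kappa> exp x (1 - \<delta> exp (- x)) = \<kappa> (exp x - \<delta>)\<close>.\<close>
  define d where "d = sqrt \<kappa> *\<^sub>R (q * a)"
  have d: "adj d = d" by (simp add: d_def adj_scaleR adj_mult q a aq)
  have "(q * a) * (q * a) = (q * q) * (a * a)" using aq by (metis mult.assoc)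
  also have "\<dots> = exp x - \<delta> *\<^sub>R 1"
    by (simp add: q a right_diff_distrib exp_minus_inverse)
  finally have dd: "d * d = \<kappa> *\<^sub>R exp x - (\<kappa> * \<delta>) *\<^sub>R 1"
    using \<kappa> by (simp add: d_def scaleR_right_diff_distrib)
  have "norm (\<kappa> *\<^sub>R exp x) \<le> \<kappa> * exp R" using \<kappa> exp_bound[OF R] by simp
  then have "norm (\<kappa> *\<^sub>R exp x) < 1" using \<kappa> by linarith
  then obtain b where b: "adj b = b" "b * b = 1 - \<kappa> *\<^sub>R exp x"
    "\<And>v. (\<kappa> *\<^sub>R exp x) * v = v * (\<kappa> *\<^sub>R exp x) \<Longrightarrow> b * v = v * b"
    using sqrt_one_minus[of "\<kappa> *\<^sub>R exp x"] by (metis adj_scaleR adj_exp x)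
  have "exp x * a = a * exp x" using aq by (metis mult.assoc q(2))
  then have xd: "exp x * d = d * exp x"
    unfolding d_def using comm[of x "(1/2) *\<^sub>R x"]
    by (simp add: q_def[symmetric]) (metis mult.assoc)
  have "b * d = d * b" by (rule b(3)) (simp add: xd)
  then have "norm (b * b) \<le> norm (b * b + d * d)"
    by (intro norm_square_le_sum_of_squares b(1) d)
  also have "b * b + d * d = (1 - \<kappa> * \<delta>) *\<^sub>R 1"
    by (simp add: b dd algebra_simps)
  also have "norm ((1 - \<kappa> * \<delta>) *\<^sub>R (1::'a)) = 1 - \<kappa> * \<delta>"
  proof -
    have "R \<ge> 0" using R norm_ge_zero[of x] by linarith
    then have "exp (- R) \<le> exp R" by simp
    then have "\<delta> \<le> exp R" using exp_gt_zero[of "- R"] unfolding \<delta>_def by linarith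
    then have "\<kappa> * \<delta> \<le> \<kappa> * exp R" using \<kappa> by (intro mult_left_mono) auto
    then have "\<kappa> * \<delta> \<le> 1" using \<kappa> by linarith
    then show ?thesis by simp
  qed
  finally show ?thesis by (simp add: b \<delta>_def)
qed

text \<open>The map \<open>x \<mapsto> x - \<kappa> (exp x - 1)\<close> shrinks \<open>w\<close> by a factor below \<open>1\<close>: along the segment from
  \<open>0\<close> to \<open>w\<close> its derivative is \<open>(1 - \<kappa> exp (s w)) w\<close>, whose first factor is bounded by the
  preceding lemma, and the mean value inequality applies.\<close>

lemma norm_sub_exp_minus_one_le:
  fixes w :: "'a::cstar_algebra"
  assumes w: "adj w = w" and \<kappa>: "0 < \<kappa>" "\<kappa> * exp (norm w) \<le> 1/2"
  shows "norm (w - \<kappa> *\<^sub>R (exp w - 1)) \<le> (1 - \<kappa> * (exp (- norm w) / 2)) * norm w"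
proof -
  define g where "g s = s *\<^sub>R w - \<kappa> *\<^sub>R exp (s *\<^sub>R w)" for s :: real
  define \<rho> where "\<rho> = 1 - \<kappa> * (exp (- norm w) / 2)"
  have der: "(g has_vector_derivative (1 - \<kappa> *\<^sub>R exp (s *\<^sub>R w)) * w) (at s within {0..1})" for s
    unfolding g_def
    by (auto intro!: derivative_eq_intros exp_scaleR_has_vector_derivative_right simp: algebra_simps)
  have "norm (g 1 - g 0) \<le> (\<rho> * norm w) * norm (1 - 0 :: real)"
  proof (rule differentiable_bound[of "{0..1}" g])
    fix s :: real assume s: "s \<in> {0..1}"
    show "(g has_derivative (\<lambda>t. t *\<^sub>R ((1 - \<kappa> *\<^sub>R exp (s *\<^sub>R w)) * w))) (at s within {0..1})"
      using der[of s] by (simp add: has_vector_derivative_def)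
    have "norm (s *\<^sub>R w) \<le> norm w"
      using s by (simp add: mult_left_le_one_le)
    then have "norm (1 - \<kappa> *\<^sub>R exp (s *\<^sub>R w)) \<le> \<rho>"
      unfolding \<rho>_def by (intro norm_one_minus_exp_le \<kappa>) (auto simp: adj_scaleR w)
    then have "norm ((1 - \<kappa> *\<^sub>R exp (s *\<^sub>R w)) * w) \<le> \<rho> * norm w"
      using norm_mult_ineq mult_right_mono norm_ge_zero order_trans by metis
    then show "onorm (\<lambda>t::real. t *\<^sub>R ((1 - \<kappa> *\<^sub>R exp (s *\<^sub>R w)) * w)) \<le> \<rho> * norm w"
      by (intro onorm_le) (simp add: mult.commute mult_left_mono)
  qed auto
  moreover have "g 1 - g 0 = w - \<kappa> *\<^sub>R (exp w - 1)"
    by (simp add: g_def scaleR_right_diff_distrib)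
  ultimately show ?thesis by (simp add: \<rho>_def)
qed

section \<open>Rapidly decreasing Fourier coefficients\<close>

lemma has_sum_diff:
  fixes f g :: "'i \<Rightarrow> 'b::real_normed_vector"
  assumes "(f has_sum a) A" and "(g has_sum b) A"
  shows "((\<lambda>x. f x - g x) has_sum (a - b)) A"
proof -
  have "((\<lambda>x. - g x) has_sum (- b)) A" using assms(2) by (simp add: has_sum_uminus)
  from has_sum_add[OF assms(1) this] show ?thesis by simp
qed

lemma summable_on_inverse_one_plus_int_square:
  "(\<lambda>m::int. 1 / (1 + (real_of_int m)\<^sup>2)) summable_on UNIV"
proof -
  have nat: "(\<lambda>n::nat. 1 / (1 + (real n)\<^sup>2)) summable_on UNIV"
  proof -
    have "summable (\<lambda>n::nat. 1 / (1 + (real n)\<^sup>2))"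
    proof (rule summable_comparison_test'[of _ 1])
      show "summable (\<lambda>n. inverse (real n ^ 2))"
        using inverse_power_summable[of 2, where ?'a = real] by simp
      show "norm (1 / (1 + (real n)\<^sup>2)) \<le> inverse (real n ^ 2)" if "n \<ge> 1" for n
        using that by (auto simp: inverse_eq_divide intro!: frac_le)
    qed
    then show ?thesis by (subst summable_on_UNIV_nonneg_real_iff) auto
  qed
  have "(\<lambda>m::int. 1 / (1 + (real_of_int m)\<^sup>2)) summable_on (range int)"
    using nat by (subst summable_on_reindex) (auto simp: o_def)
  moreover have "(\<lambda>m::int. 1 / (1 + (real_of_int m)\<^sup>2)) summable_on (range (\<lambda>n. - int n))"
    using nat by (subst summable_on_reindex) (auto simp: o_def inj_def)
  ultimately have "(\<lambda>m::int. 1 / (1 + (real_of_int m)\<^sup>2)) summable_on (range int \<union> range (\<lambda>n. - int n))"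
    by (rule summable_on_union)
  moreover have "range int \<union> range (\<lambda>n. - int n) = (UNIV :: int set)"
  proof (intro equalityI subsetI UNIV_I)
    show "m \<in> range int \<union> range (\<lambda>n. - int n)" for m :: int
      by (cases m rule: int_cases2) auto
  qed
  ultimately show ?thesis by simp
qed

text \<open>Four additional powers of the weight are enough, because
  \<open>(1 + m\<^sup>2) (1 + n\<^sup>2) \<le> (1 + |m| + |n|)\<^sup>4\<close> and \<open>1 / ((1 + m\<^sup>2) (1 + n\<^sup>2))\<close> is summable.\<close>

lemma rapidly_decreasing_summable:
  assumes "rapidly_decreasing c"
  shows "(\<lambda>(m, n). (1 + \<bar>real_of_int m\<bar> + \<bar>real_of_int n\<bar>) ^ k * cmod (c m n)) summable_on UNIV"
proof -
  define g where "g m = 1 / (1 + (real_of_int m)\<^sup>2)" for m :: int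
  obtain C where C: "\<And>m n. (1 + \<bar>real_of_int m\<bar> + \<bar>real_of_int n\<bar>) ^ (k + 4) * cmod (c m n) \<le> C"
    using assms unfolding rapidly_decreasing_def by meson
  have g: "g summable_on UNIV"
    unfolding g_def by (rule summable_on_inverse_one_plus_int_square)
  have "(\<lambda>(m, n). g m * g n) summable_on UNIV \<times> UNIV"
  proof (rule summable_on_SigmaI[where g = "\<lambda>m. g m * infsum g UNIV"])
    show "((\<lambda>n. case (m, n) of (m, n) \<Rightarrow> g m * g n) has_sum g m * infsum g UNIV) UNIV" for m
      using has_sum_cmult_right[OF has_sum_infsum[OF g], of "g m"] by simp
    show "(\<lambda>m. g m * infsum g UNIV) summable_on UNIV"
      by (rule summable_on_cmult_left[OF g])
  qed (auto simp: g_def)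
  then have "(\<lambda>(m, n). g m * g n) summable_on UNIV" by simp
  then have sum: "(\<lambda>p. C * (case p of (m, n) \<Rightarrow> g m * g n)) summable_on UNIV"
    by (rule summable_on_cmult_right)
  have "norm (case p of (m, n) \<Rightarrow> (1 + \<bar>real_of_int m\<bar> + \<bar>real_of_int n\<bar>) ^ k * cmod (c m n))
      \<le> C * (case p of (m, n) \<Rightarrow> g m * g n)" for p
  proof (cases p)
    case (Pair m n)
    let ?r = "1 + \<bar>real_of_int m\<bar> + \<bar>real_of_int n\<bar>"
    let ?d = "(1 + (real_of_int m)\<^sup>2) * (1 + (real_of_int n)\<^sup>2)"
    have sq: "1 + (real_of_int a)\<^sup>2 \<le> (1 + \<bar>real_of_int a\<bar> + b)\<^sup>2" if "b \<ge> 0" for a b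
    proof -
      have "1 + (real_of_int a)\<^sup>2 \<le> (1 + \<bar>real_of_int a\<bar>)\<^sup>2" by (simp add: power2_sum)
      also have "\<dots> \<le> (1 + \<bar>real_of_int a\<bar> + b)\<^sup>2" using that by (intro power_mono) auto
      finally show ?thesis .
    qed
    have "?d \<le> ?r\<^sup>2 * ?r\<^sup>2"
      using sq[of "\<bar>real_of_int n\<bar>" m] sq[of "\<bar>real_of_int m\<bar>" n]
      by (intro mult_mono) (auto simp: algebra_simps)
    then have d: "?d \<le> ?r ^ 4" by (simp flip: power_add)
    have "(?r ^ k * cmod (c m n)) * ?d \<le> (?r ^ k * cmod (c m n)) * ?r ^ 4"
      using d by (rule mult_left_mono) simp
    also have "\<dots> = ?r ^ (k + 4) * cmod (c m n)" by (simp add: power_add)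
    also have "\<dots> \<le> C" by (rule C)
    finally have "?r ^ k * cmod (c m n) \<le> C / ?d"
      by (subst pos_le_divide_eq) (auto intro!: mult_pos_pos add_pos_nonneg)
    then show ?thesis by (simp add: Pair g_def)
  qed
  then have "(\<lambda>p. norm (case p of (m, n) \<Rightarrow>
      (1 + \<bar>real_of_int m\<bar> + \<bar>real_of_int n\<bar>) ^ k * cmod (c m n))) summable_on UNIV"
    by (intro Infinite_Sum.abs_summable_on_comparison_test'[OF sum])
  then show ?thesis by (rule abs_summable_summable)
qed

lemma norm_unitary:
  assumes "adj W * W = (1::'a::cstar_algebra)"
  shows "norm W = 1"
proof -
  have "(norm W)\<^sup>2 = 1\<^sup>2" using cstar_identity[of W] unfolding assms by simp
  then show ?thesis by (rule power2_eq_imp_eq) simp_all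
qed

lemma norm_upow_le:
  assumes "adj W * W = (1::'a::cstar_algebra)"
  shows "norm (upow W k) \<le> 1"
proof -
  have "norm (X ^ i) \<le> 1" if "norm X = 1" for X :: 'a and i
    using norm_power_ineq[of X i] unfolding that by simp
  then show ?thesis
    using norm_unitary[OF assms] norm_adj[of W] unfolding upow_def by presburger
qed

section \<open>Gauge actions and their generators\<close>

definition fourier_multiplier :: "(int \<Rightarrow> int \<Rightarrow> int) \<Rightarrow> (int \<Rightarrow> int \<Rightarrow> complex) \<Rightarrow> int \<Rightarrow> int \<Rightarrow> complex"
  where "fourier_multiplier wt c m n = 2 * complex_of_real pi * \<i> * of_int (wt m n) * c m n"

text \<open>For \<open>wt m n = m\<close> and \<open>wt m n = n\<close> these are the derivations \<open>\<delta>\<^sub>1\<close> and \<open>\<delta>\<^sub>2\<close>.\<close>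

definition weight_derivation :: "'a::cstar_algebra \<Rightarrow> 'a \<Rightarrow> (int \<Rightarrow> int \<Rightarrow> int) \<Rightarrow> 'a \<Rightarrow> 'a"
  where "weight_derivation U V wt a = fourier_sum U V (fourier_multiplier wt (fourier_coeff U V a))"

text \<open>Contractions that multiply \<open>U\<^sup>m V\<^sup>n\<close> by \<open>exp (2 \<pi> i s wt(m, n))\<close>. On smooth elements their
  derivative at \<open>s = 0\<close> is the derivation with weight \<open>wt\<close>. The bound on the weight makes the generator preserve rapid
  decrease.\<close>

locale gauge_action =
  fixes U V :: "'a::cstar_algebra" and wt :: "int \<Rightarrow> int \<Rightarrow> int" and \<alpha> :: "real \<Rightarrow> 'a \<Rightarrow> 'a"
  assumes norm_monomial: "\<And>m n. norm (upow U m * upow V n) \<le> 1"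
    and weight_le: "\<And>m n. \<bar>wt m n\<bar> \<le> \<bar>m\<bar> + \<bar>n\<bar>"
    and act_add: "\<And>s x y. \<alpha> s (x + y) = \<alpha> s x + \<alpha> s y"
    and act_scaleC: "\<And>s c x. \<alpha> s (c *\<^sub>C x) = c *\<^sub>C \<alpha> s x"
    and act_one: "\<And>s. \<alpha> s 1 = 1"
    and act_contractive: "\<And>s x. norm (\<alpha> s x) \<le> norm x"
    and act_monomial: "\<And>s m n. \<alpha> s (upow U m * upow V n) =
          exp (\<i> * of_real (2 * pi * s * of_int (wt m n))) *\<^sub>C (upow U m * upow V n)"
begin

lemma bounded_linear_act: "bounded_linear (\<alpha> s)"
proof (rule bounded_linear_intro)
  show "\<alpha> s (x + y) = \<alpha> s x + \<alpha> s y" for x y by (rule act_add)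
  show "\<alpha> s (r *\<^sub>R x) = r *\<^sub>R \<alpha> s x" for r x
    using act_scaleC[of s "complex_of_real r" x] unfolding scaleC_of_real .
  show "norm (\<alpha> s x) \<le> norm x * 1" for x by (simp add: act_contractive)
qed

lemma act_diff_of_real: "\<alpha> s (x - of_real t) = \<alpha> s x - of_real t"
proof -
  have "\<alpha> s (of_real t) = of_real t"
    using act_scaleC[of s "complex_of_real t" 1] unfolding scaleC_of_real
    by (simp add: of_real_def act_one)
  then show ?thesis
    using linear_diff[OF bounded_linear.linear[OF bounded_linear_act]] by simp
qed

lemma has_sum_fourier_sum:
  assumes "rapidly_decreasing c"
  shows "((\<lambda>(m, n). c m n *\<^sub>C (upow U m * upow V n)) has_sum fourier_sum U V c) UNIV"
proof -
  have "(\<lambda>p. norm (case p of (m, n) \<Rightarrow> c m n *\<^sub>C (upow U m * upow V n))) summable_on UNIV"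
    using rapidly_decreasing_summable[OF assms, of 0]
    by (rule Infinite_Sum.abs_summable_on_comparison_test')
       (auto simp: norm_scaleC norm_monomial mult_left_le)
  then show ?thesis
    unfolding fourier_sum_def by (rule has_sum_infsum[OF abs_summable_summable])
qed

lemma weight_le_real: "\<bar>real_of_int (wt m n)\<bar> \<le> 1 + \<bar>real_of_int m\<bar> + \<bar>real_of_int n\<bar>"
proof -
  have "real_of_int \<bar>wt m n\<bar> \<le> real_of_int (\<bar>m\<bar> + \<bar>n\<bar>)"
    using weight_le by (simp only: of_int_le_iff)
  then show ?thesis by simp
qed

lemma rapidly_decreasing_multiplier:
  assumes "rapidly_decreasing c"
  shows "rapidly_decreasing (fourier_multiplier wt c)"
  unfolding rapidly_decreasing_def
proof
  fix k
  obtain C where C: "\<And>m n. (1 + \<bar>real_of_int m\<bar> + \<bar>real_of_int n\<bar>) ^ Suc k * cmod (c m n) \<le> C"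
    using assms unfolding rapidly_decreasing_def by meson
  have "(1 + \<bar>real_of_int m\<bar> + \<bar>real_of_int n\<bar>) ^ k * cmod (fourier_multiplier wt c m n) \<le> 2 * pi * C" for m n
  proof -
    let ?r = "1 + \<bar>real_of_int m\<bar> + \<bar>real_of_int n\<bar>"
    have "?r ^ k * cmod (fourier_multiplier wt c m n)
        = 2 * pi * (?r ^ k * cmod (c m n) * \<bar>real_of_int (wt m n)\<bar>)"
      by (simp add: fourier_multiplier_def norm_mult)
    also have "\<dots> \<le> 2 * pi * (?r ^ k * cmod (c m n) * ?r)"
      using weight_le_real by (intro mult_left_mono) auto
    also have "\<dots> \<le> 2 * pi * C"
      using C[of m n] by (intro mult_left_mono) (auto simp: mult_ac)
    finally show ?thesis .
  qed
  then show "\<exists>C. \<forall>m n. (1 + \<bar>real_of_int m\<bar> + \<bar>real_of_int n\<bar>) ^ k * cmod (fourier_multiplier wt c m n) \<le> C"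
    by blast
qed

text \<open>The expansion holds term by term: by Taylor's theorem for \<open>exp\<close>, the remainder at \<open>(m, n)\<close> is
  at most a constant times \<open>|s|\<^sup>3 (1 + |m| + |n|)\<^sup>3 |c(m, n)|\<close>, and these bounds are summable. The
  first-order term identifies the generator, the second-order term its square.\<close>

lemma act_fourier_sum_taylor:
  assumes c: "rapidly_decreasing c"
  shows "\<exists>K. \<forall>s. norm (\<alpha> s (fourier_sum U V c) - fourier_sum U V c
      - s *\<^sub>R fourier_sum U V (fourier_multiplier wt c)
      - (s\<^sup>2 / 2) *\<^sub>R fourier_sum U V (fourier_multiplier wt (fourier_multiplier wt c))) \<le> K * \<bar>s\<bar> ^ 3"
proof -
  let ?F = "fourier_sum U V" and ?D = "fourier_multiplier wt"
  define b where "b = (\<lambda>(m, n). (1 + \<bar>real_of_int m\<bar> + \<bar>real_of_int n\<bar>) ^ 3 * cmod (c m n))"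
  have b: "b summable_on UNIV"
    unfolding b_def by (rule rapidly_decreasing_summable[OF c])
  have "norm (\<alpha> s (?F c) - ?F c - s *\<^sub>R ?F (?D c) - (s\<^sup>2 / 2) *\<^sub>R ?F (?D (?D c)))
      \<le> ((2 * pi) ^ 3 / 2 * infsum b UNIV) * \<bar>s\<bar> ^ 3" for s
  proof -
    \<comment> \<open>The eigenvalue of the action is \<open>exp z\<close>, and multiplying by \<open>z\<close> is \<open>s\<close> times the derivation.\<close>
    define z where "z m n = \<i> * of_real (2 * pi * s * of_int (wt m n))" for m n
    define t where "t = (\<lambda>(m, n). ((exp (z m n) - 1 - z m n - z m n ^ 2 / 2) * c m n) *\<^sub>C (upow U m * upow V n))"
    have 1: "s *\<^sub>R (?D c m n *\<^sub>C W) = (z m n * c m n) *\<^sub>C W" for m n and W :: 'a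
      by (simp add: scaleC_of_real[symmetric] scaleC_scaleC fourier_multiplier_def z_def mult_ac)
    have 2: "(s\<^sup>2 / 2) *\<^sub>R (?D (?D c) m n *\<^sub>C W) = (z m n ^ 2 / 2 * c m n) *\<^sub>C W" for m n and W :: 'a
      by (simp add: scaleC_of_real[symmetric] scaleC_scaleC fourier_multiplier_def z_def
          power2_eq_square mult_ac)
    have 3: "\<alpha> s (c m n *\<^sub>C (upow U m * upow V n)) = (exp (z m n) * c m n) *\<^sub>C (upow U m * upow V n)" for m n
      by (simp add: act_scaleC act_monomial scaleC_scaleC z_def mult.commute)
    have t_eq: "\<alpha> s (case p of (m, n) \<Rightarrow> c m n *\<^sub>C (upow U m * upow V n))
          - (case p of (m, n) \<Rightarrow> c m n *\<^sub>C (upow U m * upow V n))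
          - s *\<^sub>R (case p of (m, n) \<Rightarrow> ?D c m n *\<^sub>C (upow U m * upow V n))
          - (s\<^sup>2 / 2) *\<^sub>R (case p of (m, n) \<Rightarrow> ?D (?D c) m n *\<^sub>C (upow U m * upow V n)) = t p" for p
      by (cases p) (simp only: prod.case 1 2 3 t_def left_diff_distrib scaleC_diff_left mult_1_left)
    have "((\<lambda>p. \<alpha> s (case p of (m, n) \<Rightarrow> c m n *\<^sub>C (upow U m * upow V n))
          - (case p of (m, n) \<Rightarrow> c m n *\<^sub>C (upow U m * upow V n))
          - s *\<^sub>R (case p of (m, n) \<Rightarrow> ?D c m n *\<^sub>C (upow U m * upow V n))
          - (s\<^sup>2 / 2) *\<^sub>R (case p of (m, n) \<Rightarrow> ?D (?D c) m n *\<^sub>C (upow U m * upow V n)))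
        has_sum (\<alpha> s (?F c) - ?F c - s *\<^sub>R ?F (?D c) - (s\<^sup>2 / 2) *\<^sub>R ?F (?D (?D c)))) UNIV"
      by (intro has_sum_diff has_sum_scaleR has_sum_bounded_linear[OF bounded_linear_act]
          has_sum_fourier_sum rapidly_decreasing_multiplier c)
    then have t: "(t has_sum (\<alpha> s (?F c) - ?F c - s *\<^sub>R ?F (?D c) - (s\<^sup>2 / 2) *\<^sub>R ?F (?D (?D c)))) UNIV"
      unfolding t_eq .
    let ?B = "(2 * pi) ^ 3 / 2 * \<bar>s\<bar> ^ 3"
    have tb: "norm (t p) \<le> ?B * b p" for p
    proof (cases p)
      case (Pair m n)
      let ?r = "1 + \<bar>real_of_int m\<bar> + \<bar>real_of_int n\<bar>"
      have "cmod (exp (z m n) - 1 - z m n - z m n ^ 2 / 2) \<le> cmod (z m n) ^ 3 / 2"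
        using Taylor_exp[of "z m n" 2]
        by (simp add: z_def numeral_2_eq_2 numeral_3_eq_3 algebra_simps)
      also have "\<dots> = ?B * \<bar>real_of_int (wt m n)\<bar> ^ 3"
        by (simp add: z_def norm_mult power_mult_distrib abs_mult)
      also have "\<dots> \<le> ?B * ?r ^ 3"
        using weight_le_real by (intro mult_left_mono power_mono) auto
      finally have e: "cmod (exp (z m n) - 1 - z m n - z m n ^ 2 / 2) \<le> ?B * ?r ^ 3" .
      have "norm (t p) \<le> cmod (exp (z m n) - 1 - z m n - z m n ^ 2 / 2) * cmod (c m n)"
        using mult_left_le[OF norm_monomial[of m n], of "cmod (exp (z m n) - 1 - z m n - z m n ^ 2 / 2) * cmod (c m n)"]
        by (simp add: t_def Pair norm_scaleC norm_mult)
      also have "\<dots> \<le> ?B * ?r ^ 3 * cmod (c m n)"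
        using e by (rule mult_right_mono) simp
      finally show ?thesis by (simp add: Pair b_def mult.assoc)
    qed
    have Bb: "(\<lambda>p. ?B * b p) summable_on UNIV" by (rule summable_on_cmult_right[OF b])
    then have ab: "(\<lambda>p. norm (t p)) summable_on UNIV"
      using tb by (rule Infinite_Sum.abs_summable_on_comparison_test')
    have "norm (\<alpha> s (?F c) - ?F c - s *\<^sub>R ?F (?D c) - (s\<^sup>2 / 2) *\<^sub>R ?F (?D (?D c))) \<le> (\<Sum>\<^sub>\<infinity>p. norm (t p))"
      using norm_has_sum_bound[OF has_sum_infsum[OF ab] t] .
    also have "\<dots> \<le> (\<Sum>\<^sub>\<infinity>p. ?B * b p)"
      by (intro infsum_mono ab Bb tb)
    also have "\<dots> = ?B * infsum b UNIV" by (rule infsum_cmult_right) (use b in auto)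
    finally show ?thesis by (simp add: mult_ac)
  qed
  then show ?thesis by (intro exI allI)
qed

text \<open>The derivative of the orbit of an element at \<open>s = 0\<close> depends on the element only. Hence the
  derivation does not depend on the coefficients that represent the element.\<close>

lemma fourier_sum_multiplier_cong:
  assumes c: "rapidly_decreasing c" and d: "rapidly_decreasing d"
    and eq: "fourier_sum U V c = fourier_sum U V d"
  shows "fourier_sum U V (fourier_multiplier wt c) = fourier_sum U V (fourier_multiplier wt d)"
proof -
  have der: "((\<lambda>s. \<alpha> s (fourier_sum U V e)) has_vector_derivative fourier_sum U V (fourier_multiplier wt e)) (at 0)"
    if e: "rapidly_decreasing e" for e
  proof -
    let ?x = "fourier_sum U V e" and ?x1 = "fourier_sum U V (fourier_multiplier wt e)"
    let ?x2 = "fourier_sum U V (fourier_multiplier wt (fourier_multiplier wt e))"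
    obtain K where "\<forall>s. norm (\<alpha> s ?x - ?x - s *\<^sub>R ?x1 - (s\<^sup>2 / 2) *\<^sub>R ?x2) \<le> K * \<bar>s\<bar> ^ 3"
      using act_fourier_sum_taylor[OF e] ..
    note K = this[rule_format]
    have a0: "\<alpha> 0 ?x = ?x" using K[of 0] by simp
    have "((\<lambda>s. (\<alpha> s ?x - \<alpha> 0 ?x - (s - 0) *\<^sub>R ?x1) /\<^sub>R norm (s - 0)) \<longlongrightarrow> 0) (at 0)"
    proof (rule Lim_null_comparison)
      show "\<forall>\<^sub>F s in at 0. norm ((\<alpha> s ?x - \<alpha> 0 ?x - (s - 0) *\<^sub>R ?x1) /\<^sub>R norm (s - 0))
          \<le> K * \<bar>s\<bar> ^ 2 + \<bar>s\<bar> / 2 * norm ?x2"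
      proof (rule eventually_mono[OF eventually_neq_at_within[of 0]])
        fix s :: real assume s: "s \<noteq> 0"
        have "norm (\<alpha> s ?x - ?x - s *\<^sub>R ?x1) \<le> K * \<bar>s\<bar> ^ 3 + s\<^sup>2 / 2 * norm ?x2"
          using K[of s] norm_triangle_sub[of "\<alpha> s ?x - ?x - s *\<^sub>R ?x1" "(s\<^sup>2 / 2) *\<^sub>R ?x2"] by simp
        also have "\<dots> = (K * \<bar>s\<bar> ^ 2 + \<bar>s\<bar> / 2 * norm ?x2) * \<bar>s\<bar>"
          by (simp add: algebra_simps power3_eq_cube power2_eq_square)
        finally have "norm (\<alpha> s ?x - ?x - s *\<^sub>R ?x1) / \<bar>s\<bar> \<le> K * \<bar>s\<bar> ^ 2 + \<bar>s\<bar> / 2 * norm ?x2"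
          using s by (subst pos_divide_le_eq) auto
        moreover have "norm (y /\<^sub>R norm (s - 0)) = norm y / \<bar>s\<bar>" for y :: 'a
          by (simp add: divide_inverse_commute)
        ultimately show "norm ((\<alpha> s ?x - \<alpha> 0 ?x - (s - 0) *\<^sub>R ?x1) /\<^sub>R norm (s - 0))
            \<le> K * \<bar>s\<bar> ^ 2 + \<bar>s\<bar> / 2 * norm ?x2"
          unfolding a0 diff_0_right by simp
      qed
      have "((\<lambda>s. K * \<bar>s\<bar> ^ 2 + \<bar>s\<bar> / 2 * norm ?x2) \<longlongrightarrow> K * \<bar>0\<bar> ^ 2 + \<bar>0\<bar> / 2 * norm ?x2) (at (0::real))"
        by (intro tendsto_intros) simp_all
      then show "((\<lambda>s. K * \<bar>s\<bar> ^ 2 + \<bar>s\<bar> / 2 * norm ?x2) \<longlongrightarrow> 0) (at (0::real))" by simp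
    qed
    then show ?thesis
      unfolding has_vector_derivative_def has_derivative_at_within
      using bounded_linear_scaleR_left by blast
  qed
  show ?thesis
    using der[OF c] der[OF d] unfolding eq by (rule vector_derivative_unique_at)
qed

lemma weight_derivation_fourier_sum:
  assumes c: "rapidly_decreasing c"
  shows "weight_derivation U V wt (fourier_sum U V c) = fourier_sum U V (fourier_multiplier wt c)"
proof -
  let ?d = "fourier_coeff U V (fourier_sum U V c)"
  have d: "rapidly_decreasing ?d \<and> fourier_sum U V c = fourier_sum U V ?d"
    unfolding fourier_coeff_def
    by (rule someI[where P = "\<lambda>d. rapidly_decreasing d \<and> fourier_sum U V c = fourier_sum U V d"
          and x = c]) (rule conjI[OF c refl])
  show ?thesis
    unfolding weight_derivation_def
    by (rule fourier_sum_multiplier_cong[OF c conjunct1[OF d] conjunct2[OF d], symmetric])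
qed

text \<open>Adding the Taylor expansions for \<open>s\<close> and \<open>- s\<close> cancels the first-order terms.\<close>

lemma second_difference:
  assumes "u \<in> smooth_elems U V"
  shows "\<exists>K. \<forall>s. norm (\<alpha> s u + \<alpha> (- s) u - 2 *\<^sub>R u
      - s\<^sup>2 *\<^sub>R weight_derivation U V wt (weight_derivation U V wt u)) \<le> K * \<bar>s\<bar> ^ 3"
proof -
  let ?D = "weight_derivation U V wt"
  obtain c where c: "rapidly_decreasing c" "u = fourier_sum U V c"
    using assms unfolding smooth_elems_def mem_Collect_eq by (elim exE conjE) (rule that)
  have Du: "?D u = fourier_sum U V (fourier_multiplier wt c)"
    "?D (?D u) = fourier_sum U V (fourier_multiplier wt (fourier_multiplier wt c))"
    by (simp_all add: c weight_derivation_fourier_sum rapidly_decreasing_multiplier)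
  have "\<exists>K. \<forall>s. norm (\<alpha> s u - u - s *\<^sub>R ?D u - (s\<^sup>2 / 2) *\<^sub>R ?D (?D u)) \<le> K * \<bar>s\<bar> ^ 3"
    unfolding Du(2) unfolding Du(1) unfolding c(2) by (rule act_fourier_sum_taylor[OF c(1)])
  then obtain K where "\<forall>s. norm (\<alpha> s u - u - s *\<^sub>R ?D u - (s\<^sup>2 / 2) *\<^sub>R ?D (?D u)) \<le> K * \<bar>s\<bar> ^ 3" ..
  note K = this[rule_format]
  have "norm (\<alpha> s u + \<alpha> (- s) u - 2 *\<^sub>R u - s\<^sup>2 *\<^sub>R ?D (?D u)) \<le> (2 * K) * \<bar>s\<bar> ^ 3" for s
  proof -
    have "s\<^sup>2 *\<^sub>R ?D (?D u) = (s\<^sup>2 / 2) *\<^sub>R ?D (?D u) + (s\<^sup>2 / 2) *\<^sub>R ?D (?D u)"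
      by (simp flip: scaleR_add_left)
    then have eq: "\<alpha> s u + \<alpha> (- s) u - 2 *\<^sub>R u - s\<^sup>2 *\<^sub>R ?D (?D u)
        = (\<alpha> s u - u - s *\<^sub>R ?D u - (s\<^sup>2 / 2) *\<^sub>R ?D (?D u))
        + (\<alpha> (- s) u - u - (- s) *\<^sub>R ?D u - ((- s)\<^sup>2 / 2) *\<^sub>R ?D (?D u))"
      by (simp add: scaleR_2)
    have "norm (\<alpha> s u + \<alpha> (- s) u - 2 *\<^sub>R u - s\<^sup>2 *\<^sub>R ?D (?D u)) \<le> K * \<bar>s\<bar> ^ 3 + K * \<bar>- s\<bar> ^ 3"
      unfolding eq by (rule norm_triangle_mono[OF K K])
    then show ?thesis by simp
  qed
  then show ?thesis by (intro exI allI)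
qed

end

section \<open>The gauge actions on the rotation algebra\<close>

lemma star_hom_type_cstar_iff:
  "\<phi> \<in> star_hom (type_cstar :: 'a::cstar_algebra cstar_structure) (type_cstar :: 'b::cstar_algebra cstar_structure)
    \<longleftrightarrow> (\<forall>x y. \<phi> (x * y) = \<phi> x * \<phi> y) \<and> (\<forall>x y. \<phi> (x + y) = \<phi> x + \<phi> y) \<and> \<phi> 1 = 1
      \<and> (\<forall>x c. \<phi> (c *\<^sub>C x) = c *\<^sub>C \<phi> x) \<and> (\<forall>x. \<phi> (adj x) = adj (\<phi> x))"
  unfolding star_hom_def ring_hom_def type_cstar_def by auto

text \<open>If \<open>a\<close> is self-adjoint with
  \<open>\<parallel>a\<parallel> < 1\<close>, then \<open>1 - a\<^sup>2 = b\<^sup>2\<close>, so \<open>\<phi>(a)\<^sup>2 + \<phi>(b)\<^sup>2 = 1\<close> and therefore \<open>\<parallel>\<phi>(a)\<parallel> \<le> 1\<close>. Scaling and the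
  \<open>C\<^sup>*\<close>-identity extend this to all elements.\<close>

lemma star_hom_contractive:
  fixes \<phi> :: "'a::cstar_algebra \<Rightarrow> 'b::cstar_algebra"
  assumes \<phi>: "\<phi> \<in> star_hom type_cstar type_cstar"
  shows "norm (\<phi> x) \<le> norm x"
proof -
  have mult: "\<phi> (x * y) = \<phi> x * \<phi> y" and add: "\<phi> (x + y) = \<phi> x + \<phi> y" and one: "\<phi> 1 = 1"
    and scaleC: "\<phi> (c *\<^sub>C x) = c *\<^sub>C \<phi> x" and adj: "\<phi> (adj x) = adj (\<phi> x)" for x y c
    using \<phi> unfolding star_hom_type_cstar_iff by auto
  have scaleR: "\<phi> (r *\<^sub>R x) = r *\<^sub>R \<phi> x" for r x
    using scaleC[of "complex_of_real r" x] unfolding scaleC_of_real .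
  have ball: "norm (\<phi> a) \<le> 1" if a: "adj a = a" "norm a < 1" for a
  proof -
    have "norm (a * a) < 1"
      using a(2) unfolding norm_square_self_adjoint[OF a(1)] by (simp add: power_less_one_iff)
    moreover have "adj (a * a) = a * a" by (simp add: adj_mult a)
    ultimately obtain b where b: "adj b = b" "b * b = 1 - a * a"
      "\<And>v. a * a * v = v * (a * a) \<Longrightarrow> b * v = v * b"
      using sqrt_one_minus by blast
    have ab: "a * b = b * a" by (rule b(3)[symmetric]) (simp add: mult.assoc)
    have sa: "adj (\<phi> a) = \<phi> a" "adj (\<phi> b) = \<phi> b"
      using adj[of a] adj[of b] by (simp_all add: a(1) b(1))
    have "\<phi> a * \<phi> b = \<phi> b * \<phi> a"
      using arg_cong[OF ab, of \<phi>] unfolding mult .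
    then have "norm (\<phi> a * \<phi> a) \<le> norm (\<phi> a * \<phi> a + \<phi> b * \<phi> b)"
      by (rule norm_square_le_sum_of_squares[OF sa])
    also have "\<phi> a * \<phi> a + \<phi> b * \<phi> b = \<phi> (a * a + b * b)" by (simp only: mult add)
    also have "\<dots> = 1" by (simp add: b(2) one)
    finally have "(norm (\<phi> a))\<^sup>2 \<le> 1\<^sup>2" by (simp add: norm_square_self_adjoint[OF sa(1)])
    then show ?thesis by (rule power2_le_imp_le) simp
  qed
  have sa: "norm (\<phi> a) \<le> norm a" if a: "adj a = a" for a
  proof (rule dense_ge)
    fix r assume r: "norm a < r"
    then have r0: "r > 0" using norm_ge_zero[of a] by linarith
    have "norm (\<phi> ((1 / r) *\<^sub>R a)) \<le> 1"
      using r r0 by (intro ball) (simp_all add: adj_scaleR a)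
    then show "norm (\<phi> a) \<le> r" using r0 by (simp add: scaleR field_simps)
  qed
  have "(norm (\<phi> x))\<^sup>2 = norm (\<phi> (adj x * x))" by (simp add: mult adj cstar_identity)
  also have "\<dots> \<le> norm (adj x * x)" by (rule sa) (simp add: adj_mult adj_adj)
  finally show ?thesis by (intro power2_le_imp_le[OF _ norm_ge_zero]) (simp add: cstar_identity)
qed

lemma rotation_pair_type_cstar_iff:
  "rotation_pair (type_cstar :: 'a::cstar_algebra cstar_structure) \<theta> U V \<longleftrightarrow>
     adj U * U = 1 \<and> U * adj U = 1 \<and> adj V * V = 1 \<and> V * adj V = 1 \<and>
     U * V = exp (2 * complex_of_real pi * \<i> * complex_of_real \<theta>) *\<^sub>C (V * U)"
  unfolding rotation_pair_def unitary_elem_def type_cstar_def by auto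

lemma upow_phase:
  fixes \<phi> :: "'a::cstar_algebra \<Rightarrow> 'b::cstar_algebra"
  assumes \<phi>: "\<phi> \<in> star_hom type_cstar type_cstar" and W: "\<phi> W = exp (\<i> * of_real r) *\<^sub>C W'"
  shows "\<phi> (upow W k) = exp (\<i> * of_real (r * of_int k)) *\<^sub>C upow W' k"
proof -
  have mult: "\<phi> (x * y) = \<phi> x * \<phi> y" and one: "\<phi> 1 = 1" and adj: "\<phi> (adj x) = adj (\<phi> x)" for x y
    using \<phi> unfolding star_hom_type_cstar_iff by auto
  have pow: "\<phi> (X ^ n) = exp (\<i> * of_real (a * of_nat n)) *\<^sub>C Y ^ n"
    if X: "\<phi> X = exp (\<i> * of_real a) *\<^sub>C Y" for X Y a n
  proof (induction n)
    case (Suc n)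
    have "\<phi> (X ^ Suc n) = (exp (\<i> * of_real a) * exp (\<i> * of_real (a * of_nat n))) *\<^sub>C Y ^ Suc n"
      by (simp add: mult X Suc mult_scaleC_left mult_scaleC_right scaleC_scaleC mult.commute)
    also have "exp (\<i> * of_real a) * exp (\<i> * of_real (a * of_nat n)) = exp (\<i> * of_real (a * of_nat (Suc n)))"
      by (simp add: algebra_simps flip: exp_add)
    finally show ?case .
  qed (simp add: one)
  have W_adj: "\<phi> (adj W) = exp (\<i> * of_real (- r)) *\<^sub>C adj W'"
    by (simp add: adj W adj_scaleC exp_cnj)
  show ?thesis
    using pow[OF W, of "nat k"] pow[OF W_adj, of "nat (- k)"] by (auto simp: upow_def)
qed

text \<open>Multiplying \<open>U\<close> and \<open>V\<close> by scalars of modulus one preserves the defining relations, so the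
  universal property, applied to the algebra itself, provides the homomorphism.\<close>

lemma rotation_algebra_phase_hom:
  fixes U V :: "'a::cstar_algebra"
  assumes rot: "rotation_algebra \<theta> U V"
  shows "\<exists>\<phi>. \<phi> \<in> star_hom type_cstar type_cstar \<and>
    \<phi> U = exp (\<i> * of_real r) *\<^sub>C U \<and> \<phi> V = exp (\<i> * of_real q) *\<^sub>C V"
proof -
  let ?A = "type_cstar :: 'a cstar_structure"
  note UV = rot[unfolded rotation_algebra_def, THEN conjunct1]
  note univ = rot[unfolded rotation_algebra_def, THEN conjunct2, THEN conjunct2, rule_format]
  have phase: "cnj (exp (\<i> * of_real a)) * exp (\<i> * of_real a) = 1" for a
    by (simp add: exp_cnj flip: exp_add)
  have unit: "adj (exp (\<i> * of_real a) *\<^sub>C W) * (exp (\<i> * of_real a) *\<^sub>C W) = adj W * W"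
    "(exp (\<i> * of_real a) *\<^sub>C W) * adj (exp (\<i> * of_real a) *\<^sub>C W) = W * adj W" for a and W :: 'a
    by (simp_all only: adj_scaleC mult_scaleC_left mult_scaleC_right scaleC_scaleC phase
        mult.commute[of "exp _" "cnj _"] scaleC_one)
  have "rotation_pair ?A \<theta> (exp (\<i> * of_real r) *\<^sub>C U) (exp (\<i> * of_real q) *\<^sub>C V)"
    using UV unfolding rotation_pair_type_cstar_iff unit
    by (simp add: mult_scaleC_left mult_scaleC_right scaleC_scaleC mult_ac)
  from univ[OF conjI[OF unital_cstar_type_cstar this]] show ?thesis
    by (rule ex1_implies_ex)
qed

text \<open>Linearity of the weight turns the phases \<open>exp (2 \<pi> i s a)\<close> on \<open>U\<close> and \<open>exp (2 \<pi> i s b)\<close> on \<open>V\<close>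
  into the phase \<open>exp (2 \<pi> i s wt(m, n))\<close> on \<open>U\<^sup>m V\<^sup>n\<close>.\<close>

lemma rotation_algebra_gauge_action:
  fixes U V :: "'a::cstar_algebra"
  assumes rot: "rotation_algebra \<theta> U V"
    and wt: "\<And>m n. real_of_int (wt m n) = a * of_int m + b * of_int n"
    and le: "\<And>m n. \<bar>wt m n\<bar> \<le> \<bar>m\<bar> + \<bar>n\<bar>"
  shows "\<exists>\<alpha>. gauge_action U V wt \<alpha>"
proof -
  have UV: "adj U * U = 1" "adj V * V = 1"
    using rot unfolding rotation_algebra_def rotation_pair_type_cstar_iff by blast+
  have "\<forall>s. \<exists>\<phi>. \<phi> \<in> star_hom type_cstar type_cstar \<and>
      \<phi> U = exp (\<i> * of_real (2 * pi * s * a)) *\<^sub>C U \<and> \<phi> V = exp (\<i> * of_real (2 * pi * s * b)) *\<^sub>C V"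
    using rotation_algebra_phase_hom[OF rot] by blast
  then obtain \<alpha> where "\<forall>s. \<alpha> s \<in> star_hom type_cstar type_cstar \<and>
      \<alpha> s U = exp (\<i> * of_real (2 * pi * s * a)) *\<^sub>C U \<and> \<alpha> s V = exp (\<i> * of_real (2 * pi * s * b)) *\<^sub>C V"
    by (rule choice[THEN exE])
  then have hom: "\<alpha> s \<in> star_hom type_cstar type_cstar"
    and act_U: "\<alpha> s U = exp (\<i> * of_real (2 * pi * s * a)) *\<^sub>C U"
    and act_V: "\<alpha> s V = exp (\<i> * of_real (2 * pi * s * b)) *\<^sub>C V" for s
    by blast+
  have "gauge_action U V wt \<alpha>"
  proof
    fix s m n
    have "norm (upow U m * upow V n) \<le> norm (upow U m) * norm (upow V n)" by (rule norm_mult_ineq)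
    also have "\<dots> \<le> 1 * 1" using norm_upow_le UV by (intro mult_mono) auto
    finally show "norm (upow U m * upow V n) \<le> 1" by simp
    have "\<alpha> s (upow U m * upow V n) = \<alpha> s (upow U m) * \<alpha> s (upow V n)"
      using hom[of s] unfolding star_hom_type_cstar_iff by blast
    also have "\<dots> = (exp (\<i> * of_real (2 * pi * s * a * of_int m)) * exp (\<i> * of_real (2 * pi * s * b * of_int n)))
        *\<^sub>C (upow U m * upow V n)"
      unfolding upow_phase[OF hom act_U] upow_phase[OF hom act_V]
      by (simp add: mult_scaleC_left mult_scaleC_right scaleC_scaleC mult.commute)
    also have "exp (\<i> * of_real (2 * pi * s * a * of_int m)) * exp (\<i> * of_real (2 * pi * s * b * of_int n))
        = exp (\<i> * of_real (2 * pi * s * of_int (wt m n)))"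
      by (simp add: wt algebra_simps flip: exp_add)
    finally show "\<alpha> s (upow U m * upow V n)
        = exp (\<i> * of_real (2 * pi * s * of_int (wt m n))) *\<^sub>C (upow U m * upow V n)" .
  next
    show "norm (\<alpha> s x) \<le> norm x" for s x by (rule star_hom_contractive[OF hom])
  qed (use hom le in \<open>simp_all add: star_hom_type_cstar_iff\<close>)
  then show ?thesis by blast
qed

section \<open>Dissipativity of the Laplacian\<close>

lemma laplacian_eq_weight_derivations:
  "laplacian U V u = weight_derivation U V (\<lambda>m n. m) (weight_derivation U V (\<lambda>m n. m) u)
     + weight_derivation U V (\<lambda>m n. n) (weight_derivation U V (\<lambda>m n. n) u)"
  unfolding laplacian_def \<delta>\<^sub>1_def \<delta>\<^sub>2_def weight_derivation_def fourier_multiplier_def[abs_def]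
  by (rule refl)

text \<open>The maximum principle in terms of norms. For \<open>x = u - t\<close>, the sum \<open>S\<close> of the translates of \<open>x\<close>
  by \<open>\<plusminus> h\<close> in the two directions satisfies \<open>S - 4 x = h\<^sup>2 \<Delta>u + O(h\<^sup>3)\<close> and \<open>\<parallel>S\<parallel> \<le> 4 \<parallel>x\<parallel>\<close>. With
  \<open>\<kappa> = \<epsilon> / h\<^sup>2\<close> this gives \<open>(1 + 4 \<kappa>) x = (x - \<epsilon> \<Delta>u) + \<kappa> S + O(\<epsilon> h)\<close>, hence
  \<open>(1 + 4 \<kappa>) \<parallel>x\<parallel> \<le> \<parallel>x - \<epsilon> \<Delta>u\<parallel> + 4 \<kappa> \<parallel>x\<parallel> + O(\<epsilon> h)\<close>. The terms \<open>4 \<kappa> \<parallel>x\<parallel>\<close> cancel, and \<open>h\<close> tends to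
  \<open>0\<close>.\<close>

lemma laplacian_dissipative:
  fixes U V :: "'a::cstar_algebra"
  assumes rot: "rotation_algebra \<theta> U V" and u: "u \<in> smooth_elems U V" and \<epsilon>: "\<epsilon> > 0"
  shows "norm (u - of_real t) \<le> norm (u - of_real t - \<epsilon> *\<^sub>R laplacian U V u)"
proof -
  obtain \<alpha> where \<alpha>: "gauge_action U V (\<lambda>m n. m) \<alpha>"
    using rotation_algebra_gauge_action[OF rot, of "\<lambda>m n. m" 1 0] by auto
  obtain \<beta> where \<beta>: "gauge_action U V (\<lambda>m n. n) \<beta>"
    using rotation_algebra_gauge_action[OF rot, of "\<lambda>m n. n" 0 1] by auto
  interpret A: gauge_action U V "\<lambda>m n. m" \<alpha> by (rule \<alpha>)
  interpret B: gauge_action U V "\<lambda>m n. n" \<beta> by (rule \<beta>)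
  let ?D1 = "weight_derivation U V (\<lambda>m n. m)" and ?D2 = "weight_derivation U V (\<lambda>m n. n)"
  define x where "x = u - of_real t"
  define L where "L = laplacian U V u"
  obtain K1 where K1: "\<forall>s. norm (\<alpha> s u + \<alpha> (- s) u - 2 *\<^sub>R u - s\<^sup>2 *\<^sub>R ?D1 (?D1 u)) \<le> K1 * \<bar>s\<bar> ^ 3"
    using A.second_difference[OF u] ..
  obtain K2 where K2: "\<forall>s. norm (\<beta> s u + \<beta> (- s) u - 2 *\<^sub>R u - s\<^sup>2 *\<^sub>R ?D2 (?D2 u)) \<le> K2 * \<bar>s\<bar> ^ 3"
    using B.second_difference[OF u] ..
  have step: "norm x \<le> norm (x - \<epsilon> *\<^sub>R L) + \<epsilon> * (K1 + K2) * h" if h: "h > 0" for h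
  proof -
    define S where "S = \<alpha> h x + \<alpha> (- h) x + \<beta> h x + \<beta> (- h) x"
    define E where "E = S - 4 *\<^sub>R x - h\<^sup>2 *\<^sub>R L"
    define \<kappa> where "\<kappa> = \<epsilon> / h\<^sup>2"
    have \<kappa>: "\<kappa> > 0" "\<kappa> * h\<^sup>2 = \<epsilon>" using h \<epsilon> by (simp_all add: \<kappa>_def)
    have four: "4 *\<^sub>R y = 2 *\<^sub>R y + 2 *\<^sub>R y" for y :: 'a
      unfolding scaleR_left_distrib[symmetric] by simp
    have "E = (\<alpha> h u + \<alpha> (- h) u - 2 *\<^sub>R u - h\<^sup>2 *\<^sub>R ?D1 (?D1 u))
        + (\<beta> h u + \<beta> (- h) u - 2 *\<^sub>R u - h\<^sup>2 *\<^sub>R ?D2 (?D2 u))"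
      unfolding E_def S_def L_def laplacian_eq_weight_derivations x_def A.act_diff_of_real
        B.act_diff_of_real four
      by (simp add: scaleR_2 scaleR_add_right algebra_simps)
    then have "norm E \<le> K1 * \<bar>h\<bar> ^ 3 + K2 * \<bar>h\<bar> ^ 3"
      using norm_triangle_mono[OF K1[rule_format, of h] K2[rule_format, of h]] by simp
    also have "\<dots> = (K1 + K2) * h * h\<^sup>2"
      using h by (simp add: algebra_simps power3_eq_cube power2_eq_square)
    finally have "\<kappa> * norm E \<le> \<kappa> * ((K1 + K2) * h * h\<^sup>2)"
      using \<kappa> by (intro mult_left_mono) auto
    also have "\<dots> = (\<kappa> * h\<^sup>2) * ((K1 + K2) * h)" by (simp only: mult_ac)
    finally have E: "\<kappa> * norm E \<le> \<epsilon> * (K1 + K2) * h" unfolding \<kappa>(2) by (simp only: mult_ac)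
    have S: "norm S \<le> 4 * norm x"
    proof -
      have "norm S \<le> norm (\<alpha> h x) + norm (\<alpha> (- h) x) + norm (\<beta> h x) + norm (\<beta> (- h) x)"
        unfolding S_def by (intro norm_triangle_mono order_refl)
      then show ?thesis
        using A.act_contractive[of h x] A.act_contractive[of "- h" x]
          B.act_contractive[of h x] B.act_contractive[of "- h" x] by linarith
    qed
    have "\<kappa> *\<^sub>R E = \<kappa> *\<^sub>R S - (\<kappa> * 4) *\<^sub>R x - \<epsilon> *\<^sub>R L"
      unfolding E_def \<kappa>(2)[symmetric] by (simp add: scaleR_diff_right)
    then have eq: "(1 + \<kappa> * 4) *\<^sub>R x = (x - \<epsilon> *\<^sub>R L) + \<kappa> *\<^sub>R S - \<kappa> *\<^sub>R E"
      by (simp add: scaleR_left_distrib)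
    have "norm ((1 + \<kappa> * 4) *\<^sub>R x) \<le> norm (x - \<epsilon> *\<^sub>R L) + norm (\<kappa> *\<^sub>R S) + norm (\<kappa> *\<^sub>R E)"
      unfolding eq using norm_triangle_ineq4[of "(x - \<epsilon> *\<^sub>R L) + \<kappa> *\<^sub>R S" "\<kappa> *\<^sub>R E"]
        norm_triangle_ineq[of "x - \<epsilon> *\<^sub>R L" "\<kappa> *\<^sub>R S"] by linarith
    moreover have "norm ((1 + \<kappa> * 4) *\<^sub>R x) = norm x + \<kappa> * (4 * norm x)"
      using \<kappa> by (simp add: distrib_right)
    moreover have "norm (\<kappa> *\<^sub>R S) \<le> \<kappa> * (4 * norm x)"
      using S \<kappa> by simp
    moreover have "norm (\<kappa> *\<^sub>R E) = \<kappa> * norm E" using \<kappa> by simp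
    ultimately show ?thesis using E by linarith
  qed
  have "norm x \<le> norm (x - \<epsilon> *\<^sub>R L)"
  proof (rule field_le_epsilon)
    fix e :: real assume e: "e > 0"
    \<comment> \<open>The step \<open>h\<close> is chosen so that the error \<open>\<epsilon> (K1 + K2) h\<close> is at most \<open>e\<close>.\<close>
    let ?C = "\<epsilon> * (K1 + K2)"
    have h: "e / (\<bar>?C\<bar> + 1) > 0" using e by simp
    have "?C * (e / (\<bar>?C\<bar> + 1)) \<le> (\<bar>?C\<bar> + 1) * (e / (\<bar>?C\<bar> + 1))"
      using h by (intro mult_right_mono) auto
    also have "\<dots> = e" by simp
    finally show "norm x \<le> norm (x - \<epsilon> *\<^sub>R L) + e"
      using step[OF h] by linarith
  qed
  then show ?thesis by (simp only: x_def L_def)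
qed

section \<open>The nonlinear equation\<close>

lemma of_real_smooth: "of_real t \<in> smooth_elems U V"
  and laplacian_of_real: "rotation_algebra \<theta> U V \<Longrightarrow> laplacian U V (of_real t) = 0"
proof -
  define c where "c m n = (if m = 0 \<and> n = 0 then complex_of_real t else 0)" for m n :: int
  have c: "rapidly_decreasing c"
    unfolding rapidly_decreasing_def c_def by (intro allI exI[of _ "\<bar>t\<bar>"]) simp
  have "fourier_sum U V c = (\<Sum>\<^sub>\<infinity>(m, n)\<in>{(0, 0)}. c m n *\<^sub>C (upow U m * upow V n))"
    unfolding fourier_sum_def by (rule infsum_cong_neutral) (auto simp: c_def scaleC_zero_left split: if_splits)
  also have "\<dots> = of_real t"
    by (simp add: c_def upow_def scaleC_of_real of_real_def[where 'a = 'a])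
  finally have sum_c: "fourier_sum U V c = of_real t" .
  then show "of_real t \<in> smooth_elems U V"
    using c unfolding smooth_elems_def mem_Collect_eq by (intro exI[of _ c] conjI) simp_all
  have zero: "fourier_sum U V (\<lambda>m n. 0) = 0"
    unfolding fourier_sum_def by (simp add: scaleC_zero_left case_prod_unfold)
  have rd0: "rapidly_decreasing (\<lambda>m n. 0)"
    unfolding rapidly_decreasing_def by auto
  assume rot: "rotation_algebra \<theta> U V"
  have der: "weight_derivation U V wt (weight_derivation U V wt (of_real t)) = 0"
    if \<alpha>: "gauge_action U V wt \<alpha>" and wt: "wt 0 0 = 0" for wt \<alpha>
  proof -
    interpret gauge_action U V wt \<alpha> by (rule \<alpha>)
    have "fourier_multiplier wt c = (\<lambda>m n. 0)" "fourier_multiplier wt (\<lambda>m n. 0) = (\<lambda>m n. 0)"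
      by (intro ext; simp add: fourier_multiplier_def c_def wt)+
    then show ?thesis
      using weight_derivation_fourier_sum[OF c] weight_derivation_fourier_sum[OF rd0]
      by (simp add: sum_c zero)
  qed
  obtain \<alpha> where \<alpha>: "gauge_action U V (\<lambda>m n. m) \<alpha>"
    using rotation_algebra_gauge_action[OF rot, of "\<lambda>m n. m" 1 0] by auto
  obtain \<beta> where \<beta>: "gauge_action U V (\<lambda>m n. n) \<beta>"
    using rotation_algebra_gauge_action[OF rot, of "\<lambda>m n. n" 0 1] by auto
  show "laplacian U V (of_real t) = 0"
    unfolding laplacian_eq_weight_derivations der[OF \<alpha> refl] der[OF \<beta> refl] by simp
qed

theorem theorem4p3:
  fixes \<theta> lam \<mu> :: real and U V :: "'a::cstar_algebra"
  assumes "\<theta> \<notin> \<rat>"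
    and "rotation_algebra \<theta> U V"
    and "lam > 0" and "\<mu> > 0"
  shows "\<forall>u. (u \<in> smooth_elems U V \<and> adj u = u \<and>
                laplacian U V u = \<mu> *\<^sub>R exp u - of_real lam)
             \<longleftrightarrow> u = of_real (ln (lam / \<mu>))"
proof (intro allI iffI)
  note rot = assms(2)
  define t where "t = ln (lam / \<mu>)"
  have exp_t: "\<mu> * exp t = lam" using assms(3,4) by (simp add: t_def)
  fix u :: 'a
  {
    assume "u \<in> smooth_elems U V \<and> adj u = u \<and> laplacian U V u = \<mu> *\<^sub>R exp u - of_real lam"
    then have u: "u \<in> smooth_elems U V" "adj u = u" "laplacian U V u = \<mu> *\<^sub>R exp u - of_real lam"
      by auto
    define w where "w = u - of_real t"
    have w: "adj w = w" by (simp add: w_def adj_diff u)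
    have "exp (w + of_real t) = exp w * exp (of_real t)"
      by (rule exp_add_commuting) (simp add: of_real_def)
    then have "exp u = exp w * of_real (exp t)" by (simp add: w_def exp_of_real)
    then have "\<mu> *\<^sub>R exp u = lam *\<^sub>R exp w"
      unfolding exp_t[symmetric] by (simp add: of_real_def)
    then have lap: "laplacian U V u = lam *\<^sub>R (exp w - 1)"
      unfolding u(3) by (simp add: of_real_def scaleR_diff_right)
    \<comment> \<open>The largest \<open>\<kappa>\<close> with \<open>\<kappa> exp \<parallel>w\<parallel> \<le> 1/2\<close>; dissipativity is then used with \<open>\<epsilon> = \<kappa> / \<lambda>\<close>.\<close>
    define \<kappa> where "\<kappa> = exp (- norm w) / 2"
    have \<kappa>: "\<kappa> > 0" "\<kappa> * exp (norm w) \<le> 1 / 2" by (simp_all add: \<kappa>_def exp_minus)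
    define k where "k = \<kappa> * (exp (- norm w) / 2)"
    have "norm w \<le> norm (w - (\<kappa> / lam) *\<^sub>R laplacian U V u)"
      unfolding w_def using laplacian_dissipative[OF rot u(1)] \<kappa>(1) assms(3) by simp
    also have "(\<kappa> / lam) *\<^sub>R laplacian U V u = \<kappa> *\<^sub>R (exp w - 1)"
      unfolding lap using assms(3) by simp
    also have "norm (w - \<kappa> *\<^sub>R (exp w - 1)) \<le> (1 - \<kappa> * (exp (- norm w) / 2)) * norm w"
      by (rule norm_sub_exp_minus_one_le[OF w \<kappa>])
    finally have "norm w \<le> (1 - k) * norm w" by (simp only: k_def)
    then have "k * norm w \<le> 0" by (simp add: left_diff_distrib)
    moreover have "k > 0" using \<kappa>(1) by (simp add: k_def)
    ultimately have "norm w \<le> 0" by (simp add: mult_le_0_iff)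
    then show "u = of_real (ln (lam / \<mu>))" by (simp add: w_def t_def)
  }
  assume "u = of_real (ln (lam / \<mu>))"
  then have u: "u = of_real t" by (simp only: t_def)
  have "\<mu> *\<^sub>R exp u - of_real lam = 0"
    unfolding u exp_of_real exp_t[symmetric] by (simp add: of_real_def)
  then show "u \<in> smooth_elems U V \<and> adj u = u \<and> laplacian U V u = \<mu> *\<^sub>R exp u - of_real lam"
    unfolding u using of_real_smooth laplacian_of_real[OF rot] by simp
qed

end
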